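(* Let $S$ be a semiring. Then $S$ is exact if and only if the following two conditions hold for all positive integers $m,n$ and all $A\in S^{m\times n}$. (G1) The left embedding $\operatorname{Row}(A)\to\operatorname{Col}(A)^*$ given by $x\mapsto(Av\mapsto xv)$ (where $v\in S^{n\times 1}$) is surjective. (G2) The right embedding $\operatorname{Col}(A)\to\operatorname{Row}(A)^*$ given by $y\mapsto(uA\mapsto uy)$ (where $u\in S^{1\times m}$) is surjective.
   Context: A semiring is a set $S$ with a commutative associative addition and an associative (not necessarily commutative) multiplication distributing over addition from both sides, such that for every non-empty finite subset $L\subseteq S$ there are local identities $0_L,1_L\in S$ with $a+0_Lb=1_La=a$ and $a+b0_L=a1_L=a$ for all $a,b\in L$. (No global zero or identity is required.) $S^{m\times n}$ is the set of $m\times n$ matrices over $S$, with the usual matrix addition and multiplication. For $A\in S^{m\times n}$, $\operatorname{Row}(A)=\{uA: u\in S^{1\times m}\}\subseteq S^{1\times n}$ (a left $S$-module) and $\operatorname{Col}(A)=\{Av: v\in S^{n\times 1}\}\subseteq S^{m\times 1}$ (a right $S$-module). A function $\phi$ between left $S$-modules is left linear if $\phi(ax+by)=a(\phi x)+b(\phi y)$ for all elements $x,y$ and all $a,b\in S$; right linear functions between right $S$-modules are defined similarly. An embedding is an injective linear function. $\operatorname{Col}(A)^*$ is the left $S$-module of all right linear functions $\operatorname{Col}(A)\to S$ (pointwise addition, $(a\phi)y=a(\phi y)$), and $\operatorname{Row}(A)^*$ is the right $S$-module of all left linear functions $\operatorname{Row}(A)\to S$ (pointwise addition, $(\phi a)x=(\phi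 x)a$). The maps in (G1) and (G2) are well-defined embeddings for every semiring $S$. $S$ is exact if for all positive integers $m,n$ and all $A\in S^{m\times n}$: (E1) if $x\in S^{1\times n}\setminus\operatorname{Row}(A)$ then there are $v,v'\in S^{n\times 1}$ with $Av=Av'$ but $xv\neq xv'$; and (E2) if $y\in S^{m\times 1}\setminus\operatorname{Col}(A)$ then there are $u,u'\in S^{1\times m}$ with $uA=u'A$ but $uy\neq u'y$. *)

theory Defs
  imports "Jordan_Normal_Form.Matrix" "HOL-Library.FuncSet"
begin

text \<open>
  The library class \<^class>\<open>semiring\<close> has neither a zero nor an identity and its multiplication need
  not commute. A single \<open>z\<close> and a single \<open>e\<close> must serve all pairs from \<open>L\<close>, on both sides.
\<close>

class semiring_local_id = semiring +
  assumes local_id: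
    "finite L \<Longrightarrow> L \<noteq> {} \<Longrightarrow>
      \<exists>z e. \<forall>a\<in>L. \<forall>b\<in>L. a + z * b = a \<and> e * a = a \<and> a + b * z = a \<and> a * e = a"

text \<open>
  Neither \<^const>\<open>sum\<close> nor the matrix product of the library is available without a zero.
  \<open>sum_upto f n\<close> is the non-empty sum \<open>f 0 + \<dots> + f n\<close> of \<open>n + 1\<close> terms, and \<open>A \<star> B\<close> is the
  matrix product whenever the inner dimension is positive.
\<close>

primrec sum_upto :: "(nat \<Rightarrow> 'a::semiring) \<Rightarrow> nat \<Rightarrow> 'a" where
  "sum_upto f 0 = f 0"
| "sum_upto f (Suc n) = sum_upto f n + f (Suc n)"

definition mat_prod :: "'a::semiring mat \<Rightarrow> 'a mat \<Rightarrow> 'a mat" (infixl \<open>\<star>\<close> 70) where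
  "A \<star> B = mat (dim_row A) (dim_col B)
     (\<lambda>(i, j). sum_upto (\<lambda>k. A $$ (i, k) * B $$ (k, j)) (dim_col A - 1))"

text \<open>The left scalar action is the library's \<^const>\<open>smult_mat\<close>.\<close>

definition smult_mat_right :: "'a::semiring mat \<Rightarrow> 'a \<Rightarrow> 'a mat" (infixl \<open>\<cdot>\<^sub>r\<close> 70) where
  "A \<cdot>\<^sub>r a = map_mat (\<lambda>b. b * a) A"

definition Row :: "'a::semiring mat \<Rightarrow> 'a mat set" where
  "Row A = {u \<star> A | u. u \<in> carrier_mat 1 (dim_row A)}"

definition Col :: "'a::semiring mat \<Rightarrow> 'a mat set" where
  "Col A = {A \<star> v | v. v \<in> carrier_mat (dim_col A) 1}"

text \<open>
  The duals. A function on \<open>Row A\<close> or \<open>Col A\<close> is represented by its unique extensional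
  representative (\<^const>\<open>undefined\<close> off the domain), so that equality in \<open>HOL\<close> is equality of
  functions on the module.
\<close>

definition Row_dual :: "'a::semiring mat \<Rightarrow> ('a mat \<Rightarrow> 'a) set" where
  "Row_dual A = {\<phi> \<in> Row A \<rightarrow>\<^sub>E UNIV. \<forall>x\<in>Row A. \<forall>y\<in>Row A. \<forall>a b.
     \<phi> (a \<cdot>\<^sub>m x + b \<cdot>\<^sub>m y) = a * \<phi> x + b * \<phi> y}"

definition Col_dual :: "'a::semiring mat \<Rightarrow> ('a mat \<Rightarrow> 'a) set" where
  "Col_dual A = {\<phi> \<in> Col A \<rightarrow>\<^sub>E UNIV. \<forall>x\<in>Col A. \<forall>y\<in>Col A. \<forall>a b.
     \<phi> (x \<cdot>\<^sub>r a + y \<cdot>\<^sub>r b) = \<phi> x * a + \<phi> y * b}"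

text \<open>
  The two canonical maps. A \<open>1 \<times> 1\<close> matrix is identified with its only entry. The value at \<open>y\<close> is
  described through any representation of \<open>y\<close>; the lemmas \<open>Row_to_Col_dual_apply\<close> and
  \<open>Col_to_Row_dual_apply\<close> below show that it does not depend on the choice.
\<close>

definition Row_to_Col_dual :: "'a::semiring mat \<Rightarrow> 'a mat \<Rightarrow> ('a mat \<Rightarrow> 'a)" where
  "Row_to_Col_dual A x = (\<lambda>y\<in>Col A.
     THE s. \<exists>v\<in>carrier_mat (dim_col A) 1. y = A \<star> v \<and> s = (x \<star> v) $$ (0, 0))"

definition Col_to_Row_dual :: "'a::semiring mat \<Rightarrow> 'a mat \<Rightarrow> ('a mat \<Rightarrow> 'a)" where
  "Col_to_Row_dual A y = (\<lambda>x\<in>Row A.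
     THE s. \<exists>u\<in>carrier_mat 1 (dim_row A). x = u \<star> A \<and> s = (u \<star> y) $$ (0, 0))"

definition exact_semiring :: "'a::semiring itself \<Rightarrow> bool" where
  "exact_semiring _ \<longleftrightarrow> (\<forall>m n. 0 < m \<longrightarrow> 0 < n \<longrightarrow> (\<forall>A :: 'a mat \<in> carrier_mat m n.
     (\<forall>x \<in> carrier_mat 1 n - Row A.
        \<exists>v\<in>carrier_mat n 1. \<exists>v'\<in>carrier_mat n 1. A \<star> v = A \<star> v' \<and> x \<star> v \<noteq> x \<star> v') \<and>
     (\<forall>y \<in> carrier_mat m 1 - Col A.
        \<exists>u\<in>carrier_mat 1 m. \<exists>u'\<in>carrier_mat 1 m. u \<star> A = u' \<star> A \<and> u \<star> y \<noteq> u' \<star> y)))"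

lemma dim_mat_prod [simp]: "dim_row (A \<star> B) = dim_row A" "dim_col (A \<star> B) = dim_col B"
  by (simp_all add: mat_prod_def)

lemma mat_prod_carrier [simp]:
  "A \<in> carrier_mat m k \<Longrightarrow> B \<in> carrier_mat k n \<Longrightarrow> A \<star> B \<in> carrier_mat m n"
  by (metis carrier_matD carrier_matI dim_mat_prod)

lemma index_mat_prod:
  "i < dim_row A \<Longrightarrow> j < dim_col B \<Longrightarrow>
    (A \<star> B) $$ (i, j) = sum_upto (\<lambda>k. A $$ (i, k) * B $$ (k, j)) (dim_col A - 1)"
  by (simp add: mat_prod_def)

lemma sum_upto_cong: "(\<And>k. k \<le> n \<Longrightarrow> f k = g k) \<Longrightarrow> sum_upto f n = sum_upto g n"
  by (induction n) auto

lemma sum_upto_add: "sum_upto (\<lambda>k. f k + g k) n = sum_upto f n + sum_upto g n"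
  by (induction n) (auto simp: algebra_simps)

lemma sum_upto_mult_left: "a * sum_upto f n = sum_upto (\<lambda>k. a * f k) n"
  by (induction n) (auto simp: algebra_simps)

lemma sum_upto_mult_right: "sum_upto f n * a = sum_upto (\<lambda>k. f k * a) n"
  by (induction n) (auto simp: algebra_simps)

lemma sum_upto_swap:
  "sum_upto (\<lambda>i. sum_upto (f i) n) m = sum_upto (\<lambda>j. sum_upto (\<lambda>i. f i j) m) n"
  by (induction m) (simp_all add: sum_upto_add)

lemma mat_prod_assoc:
  assumes "A \<in> carrier_mat m k" "B \<in> carrier_mat k l" "C \<in> carrier_mat l n" "0 < k" "0 < l"
  shows "(A \<star> B) \<star> C = A \<star> (B \<star> C)"
proof (rule eq_matI)
  fix i j assume "i < dim_row (A \<star> (B \<star> C))" "j < dim_col (A \<star> (B \<star> C))"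
  then have ij: "i < m" "j < n" using assms by auto
  have "((A \<star> B) \<star> C) $$ (i, j) =
      sum_upto (\<lambda>q. sum_upto (\<lambda>p. A $$ (i, p) * B $$ (p, q)) (k - 1) * C $$ (q, j)) (l - 1)"
    using assms ij by (auto simp: index_mat_prod intro!: sum_upto_cong)
  also have "\<dots> = sum_upto (\<lambda>p. A $$ (i, p) * sum_upto (\<lambda>q. B $$ (p, q) * C $$ (q, j)) (l - 1)) (k - 1)"
    by (simp add: sum_upto_mult_left sum_upto_mult_right mult.assoc) (rule sum_upto_swap)
  also have "\<dots> = (A \<star> (B \<star> C)) $$ (i, j)"
    using assms ij by (auto simp: index_mat_prod intro!: sum_upto_cong)
  finally show "((A \<star> B) \<star> C) $$ (i, j) = (A \<star> (B \<star> C)) $$ (i, j)" .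
qed (use assms in auto)

lemma Row_to_Col_dual_apply:
  assumes A: "A \<in> carrier_mat m n" "0 < m" "0 < n"
    and x: "x \<in> Row A" and v: "v \<in> carrier_mat n 1"
  shows "Row_to_Col_dual A x (A \<star> v) = (x \<star> v) $$ (0, 0)"
proof -
  obtain u where u: "u \<in> carrier_mat 1 m" "x = u \<star> A" using x A by (auto simp: Row_def)
  have *: "x \<star> w = u \<star> (A \<star> w)" if "w \<in> carrier_mat n 1" for w
    using u A that mat_prod_assoc by blast
  have "A \<star> v \<in> Col A" using A v by (auto simp: Col_def)
  then show ?thesis
    unfolding Row_to_Col_dual_def using A v * by (auto intro!: the_equality)
qed

lemma Col_to_Row_dual_apply:
  assumes A: "A \<in> carrier_mat m n" "0 < m" "0 < n"
    and y: "y \<in> Col A" and u: "u \<in> carrier_mat 1 m"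
  shows "Col_to_Row_dual A y (u \<star> A) = (u \<star> y) $$ (0, 0)"
proof -
  obtain v where v: "v \<in> carrier_mat n 1" "y = A \<star> v" using y A by (auto simp: Col_def)
  have *: "w \<star> y = (w \<star> A) \<star> v" if "w \<in> carrier_mat 1 m" for w
    using v A that mat_prod_assoc by metis
  have "u \<star> A \<in> Row A" using A u by (auto simp: Row_def)
  then show ?thesis
    unfolding Col_to_Row_dual_def using A u * by (auto intro!: the_equality)
qed

lemma mat_prod_add_right:
  assumes "A \<in> carrier_mat m k" "B \<in> carrier_mat k n" "C \<in> carrier_mat k n" "0 < k"
  shows "A \<star> (B \<cdot>\<^sub>r a + C \<cdot>\<^sub>r b) = (A \<star> B) \<cdot>\<^sub>r a + (A \<star> C) \<cdot>\<^sub>r b"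
proof (rule eq_matI)
  fix i j assume "i < dim_row ((A \<star> B) \<cdot>\<^sub>r a + (A \<star> C) \<cdot>\<^sub>r b)"
    "j < dim_col ((A \<star> B) \<cdot>\<^sub>r a + (A \<star> C) \<cdot>\<^sub>r b)"
  then have ij: "i < m" "j < n" using assms by (auto simp: smult_mat_right_def)
  have "(A \<star> (B \<cdot>\<^sub>r a + C \<cdot>\<^sub>r b)) $$ (i, j) =
      sum_upto (\<lambda>q. A $$ (i, q) * B $$ (q, j) * a + A $$ (i, q) * C $$ (q, j) * b) (k - 1)"
    using assms ij
    by (auto simp: index_mat_prod smult_mat_right_def algebra_simps intro!: sum_upto_cong)
  then show "(A \<star> (B \<cdot>\<^sub>r a + C \<cdot>\<^sub>r b)) $$ (i, j) = ((A \<star> B) \<cdot>\<^sub>r a + (A \<star> C) \<cdot>\<^sub>r b) $$ (i, j)"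
    using assms ij
    by (simp add: index_mat_prod smult_mat_right_def sum_upto_add sum_upto_mult_right)
qed (use assms in \<open>auto simp: smult_mat_right_def\<close>)

lemma mat_prod_add_left:
  assumes "A \<in> carrier_mat k n" "B \<in> carrier_mat m k" "C \<in> carrier_mat m k" "0 < k"
  shows "(a \<cdot>\<^sub>m B + b \<cdot>\<^sub>m C) \<star> A = a \<cdot>\<^sub>m (B \<star> A) + b \<cdot>\<^sub>m (C \<star> A)"
proof (rule eq_matI)
  fix i j assume "i < dim_row (a \<cdot>\<^sub>m (B \<star> A) + b \<cdot>\<^sub>m (C \<star> A))"
    "j < dim_col (a \<cdot>\<^sub>m (B \<star> A) + b \<cdot>\<^sub>m (C \<star> A))"
  then have ij: "i < m" "j < n" using assms by auto
  have "((a \<cdot>\<^sub>m B + b \<cdot>\<^sub>m C) \<star> A) $$ (i, j) =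
      sum_upto (\<lambda>q. a * (B $$ (i, q) * A $$ (q, j)) + b * (C $$ (i, q) * A $$ (q, j))) (k - 1)"
    using assms ij by (auto simp: index_mat_prod algebra_simps intro!: sum_upto_cong)
  then show "((a \<cdot>\<^sub>m B + b \<cdot>\<^sub>m C) \<star> A) $$ (i, j) = (a \<cdot>\<^sub>m (B \<star> A) + b \<cdot>\<^sub>m (C \<star> A)) $$ (i, j)"
    using assms ij by (simp add: index_mat_prod sum_upto_add sum_upto_mult_left)
qed (use assms in auto)

lemma Row_to_Col_dual_in_dual:
  assumes A: "A \<in> carrier_mat m n" "0 < m" "0 < n" and x: "x \<in> Row A"
  shows "Row_to_Col_dual A x \<in> Col_dual A"
proof -
  have xc: "x \<in> carrier_mat 1 n" using x A by (auto simp: Row_def)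
  have "Row_to_Col_dual A x (y \<cdot>\<^sub>r a + z \<cdot>\<^sub>r b) =
      Row_to_Col_dual A x y * a + Row_to_Col_dual A x z * b"
    if yz: "y \<in> Col A" "z \<in> Col A" for y z a b
  proof -
    obtain v w where vw: "v \<in> carrier_mat n 1" "w \<in> carrier_mat n 1" "y = A \<star> v" "z = A \<star> w"
      using yz unfolding Col_def carrier_matD(2)[OF A(1)] by blast
    have c: "v \<cdot>\<^sub>r a + w \<cdot>\<^sub>r b \<in> carrier_mat n 1" using vw(1,2) by (simp add: smult_mat_right_def)
    have e: "y \<cdot>\<^sub>r a + z \<cdot>\<^sub>r b = A \<star> (v \<cdot>\<^sub>r a + w \<cdot>\<^sub>r b)"
      using mat_prod_add_right[OF A(1) vw(1,2) A(3)] by (simp only: vw(3,4))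
    have "Row_to_Col_dual A x (y \<cdot>\<^sub>r a + z \<cdot>\<^sub>r b) =
        (x \<star> (v \<cdot>\<^sub>r a + w \<cdot>\<^sub>r b)) $$ (0, 0)"
      unfolding e by (rule Row_to_Col_dual_apply[OF A x c])
    also have "\<dots> = (x \<star> v) $$ (0, 0) * a + (x \<star> w) $$ (0, 0) * b"
      unfolding mat_prod_add_right[OF xc vw(1,2) A(3)]
      using vw(1,2) xc by (simp add: smult_mat_right_def)
    finally show ?thesis
      unfolding vw(3,4) Row_to_Col_dual_apply[OF A x vw(1)] Row_to_Col_dual_apply[OF A x vw(2)] .
  qed
  moreover have "Row_to_Col_dual A x \<in> Col A \<rightarrow>\<^sub>E UNIV"
    by (simp add: Row_to_Col_dual_def)
  ultimately show ?thesis unfolding Col_dual_def by blast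
qed

lemma Col_to_Row_dual_in_dual:
  assumes A: "A \<in> carrier_mat m n" "0 < m" "0 < n" and y: "y \<in> Col A"
  shows "Col_to_Row_dual A y \<in> Row_dual A"
proof -
  have yc: "y \<in> carrier_mat m 1" using y A by (auto simp: Col_def)
  have "Col_to_Row_dual A y (a \<cdot>\<^sub>m x + b \<cdot>\<^sub>m z) =
      a * Col_to_Row_dual A y x + b * Col_to_Row_dual A y z"
    if xz: "x \<in> Row A" "z \<in> Row A" for x z a b
  proof -
    obtain v w where vw: "v \<in> carrier_mat 1 m" "w \<in> carrier_mat 1 m" "x = v \<star> A" "z = w \<star> A"
      using xz unfolding Row_def carrier_matD(1)[OF A(1)] by blast
    have c: "a \<cdot>\<^sub>m v + b \<cdot>\<^sub>m w \<in> carrier_mat 1 m" using vw(1,2) by simp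
    have e: "a \<cdot>\<^sub>m x + b \<cdot>\<^sub>m z = (a \<cdot>\<^sub>m v + b \<cdot>\<^sub>m w) \<star> A"
      using mat_prod_add_left[OF A(1) vw(1,2) A(2)] by (simp only: vw(3,4))
    have "Col_to_Row_dual A y (a \<cdot>\<^sub>m x + b \<cdot>\<^sub>m z) =
        ((a \<cdot>\<^sub>m v + b \<cdot>\<^sub>m w) \<star> y) $$ (0, 0)"
      unfolding e by (rule Col_to_Row_dual_apply[OF A y c])
    also have "\<dots> = a * (v \<star> y) $$ (0, 0) + b * (w \<star> y) $$ (0, 0)"
      unfolding mat_prod_add_left[OF yc vw(1,2) A(2)]
      using vw(1,2) yc by simp
    finally show ?thesis
      unfolding vw(3,4) Col_to_Row_dual_apply[OF A y vw(1)] Col_to_Row_dual_apply[OF A y vw(2)] .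
  qed
  moreover have "Col_to_Row_dual A y \<in> Row A \<rightarrow>\<^sub>E UNIV"
    by (simp add: Col_to_Row_dual_def)
  ultimately show ?thesis unfolding Row_dual_def by blast
qed

end

theory Submission
  imports Defs
begin

text \<open>
  The equivalence holds matrix by matrix: for each fixed \<open>A\<close>, the separation condition (E1) is
  equivalent to the surjectivity (G1), and (E2) to (G2).

  A \<open>1 \<times> 1\<close> matrix is identified with its entry. A right linear function \<open>\<phi>\<close> on \<open>Col A\<close> is
  determined by its values on the columns of \<open>A\<close>: if \<open>x\<close> is the row of these values, then
  \<open>\<phi> (A \<star> v) = x \<star> v\<close> for every \<open>v\<close>
  (\<open>Col_dual_representation\<close>). In particular \<open>A \<star> v = A \<star> v'\<close> implies \<open>x \<star> v = x \<star> v'\<close>, so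
  (E1) forces \<open>x \<in> Row A\<close>, and \<open>\<phi>\<close> is the image of \<open>x\<close>. Conversely, if a row \<open>x\<close> satisfies this
  implication, then \<open>A \<star> v \<mapsto> x \<star> v\<close> is a well-defined right linear function
  (\<open>Col_dual_of_row\<close>). By (G1) it is given by some \<open>x' \<in> Row A\<close>, so that \<open>x \<star> v = x' \<star> v\<close> for all
  \<open>v\<close>, whence \<open>x = x'\<close> (\<open>row_eqI\<close>).

  In the absence of a zero and an identity, the standard basis vectors are replaced by vectors with
  a local identity in one place and local zeros elsewhere, chosen for the finitely many scalars at
  hand (\<open>local_unit_col\<close>). The other side is the mirror image; since multiplication
  need not commute, it is not an instance of the first.
\<close>

section \<open>Local unit vectors\<close>

lemma sum_upto_absorb:
  assumes "\<And>k. k \<le> n \<Longrightarrow> a + f k = a"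
  shows "a + sum_upto f n = (a :: 'a::semiring)"
  using assms by (induction n) (simp_all flip: add.assoc)

lemma sum_upto_single:
  fixes f :: "nat \<Rightarrow> 'a::semiring"
  assumes "j \<le> n" and "\<And>k. k \<le> n \<Longrightarrow> k \<noteq> j \<Longrightarrow> f j + f k = f j"
  shows "sum_upto f n = f j"
  using assms
proof (induction n)
  case 0
  then show ?case by simp
next
  case (Suc n)
  show ?case
  proof (cases "j = Suc n")
    case True
    have "f j + sum_upto f n = f j"
      using Suc.prems True by (intro sum_upto_absorb) auto
    then show ?thesis using True by (simp add: add.commute)
  next
    case False
    then have "sum_upto f n = f j" using Suc by auto
    then show ?thesis using Suc.prems False by auto
  qed
qed

lemma finite_elements_mat: "finite (elements_mat A)"
  by (simp add: elements_mat_def)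

lemma index_in_elements_mat:
  "i < dim_row A \<Longrightarrow> j < dim_col A \<Longrightarrow> A $$ (i, j) \<in> elements_mat A"
  by (rule elements_matI[of A "dim_row A" "dim_col A"]) auto

text \<open>The \<open>j\<close>-th column and the \<open>i\<close>-th row, kept as matrices so that they are elements of \<open>Col A\<close> and \<open>Row A\<close>.\<close>

definition column :: "'a mat \<Rightarrow> nat \<Rightarrow> 'a mat" where
  "column A j = mat (dim_row A) 1 (\<lambda>(i, _). A $$ (i, j))"

definition line :: "'a mat \<Rightarrow> nat \<Rightarrow> 'a mat" where
  "line A i = mat 1 (dim_col A) (\<lambda>(_, j). A $$ (i, j))"

text \<open>
  One vector extracts the \<open>j\<close>-th column of all matrices with entries in \<open>L\<close> simultaneously; to
  compare two rows, one such vector is needed for both.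
\<close>

lemma local_unit_col:
  fixes L :: "'a::semiring_local_id set"
  assumes "finite L" and j: "j < n"
  obtains w where "w \<in> carrier_mat n 1"
    and "\<And>A. dim_col A = n \<Longrightarrow> elements_mat A \<subseteq> L \<Longrightarrow> A \<star> w = column A j"
proof -
  obtain z e where z: "\<And>a b. a \<in> L \<Longrightarrow> b \<in> L \<Longrightarrow> a + b * z = a"
    and e: "\<And>a. a \<in> L \<Longrightarrow> a * e = a"
  proof (cases "L = {}")
    case False
    show thesis using local_id[OF assms(1) False] that by blast
  qed (use that in auto)
  define w where "w = mat n 1 (\<lambda>(i, _). if i = j then e else z)"
  show thesis
  proof
    show "w \<in> carrier_mat n 1" by (simp add: w_def)
    fix A :: "'a mat" assume A: "dim_col A = n" "elements_mat A \<subseteq> L"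
    show "A \<star> w = column A j"
    proof (rule eq_matI)
      fix i q assume "i < dim_row (column A j)" "q < dim_col (column A j)"
      then have i: "i < dim_row A" "q = 0" by (auto simp: column_def)
      have L: "A $$ (i, k) \<in> L" if "k < n" for k using A i that index_in_elements_mat[of i A k] by auto
      have "(A \<star> w) $$ (i, q) =
          sum_upto (\<lambda>k. A $$ (i, k) * (if k = j then e else z)) (n - 1)"
        using A i j by (auto simp: index_mat_prod w_def intro!: sum_upto_cong)
      also have "\<dots> = A $$ (i, j) * e"
        using j by (subst sum_upto_single[where j = j]) (auto simp: z e L)
      also have "\<dots> = A $$ (i, j)" using e L j by blast
      finally show "(A \<star> w) $$ (i, q) = column A j $$ (i, q)" using i by (simp add: column_def)
    qed (auto simp: column_def w_def)
  qed
qed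

lemma local_unit_row:
  fixes L :: "'a::semiring_local_id set"
  assumes "finite L" and i: "i < m"
  obtains w where "w \<in> carrier_mat 1 m"
    and "\<And>A. dim_row A = m \<Longrightarrow> elements_mat A \<subseteq> L \<Longrightarrow> w \<star> A = line A i"
proof -
  obtain z e where z: "\<And>a b. a \<in> L \<Longrightarrow> b \<in> L \<Longrightarrow> a + z * b = a"
    and e: "\<And>a. a \<in> L \<Longrightarrow> e * a = a"
  proof (cases "L = {}")
    case False
    show thesis using local_id[OF assms(1) False] that by blast
  qed (use that in auto)
  define w where "w = mat 1 m (\<lambda>(_, k). if k = i then e else z)"
  show thesis
  proof
    show "w \<in> carrier_mat 1 m" by (simp add: w_def)
    fix A :: "'a mat" assume A: "dim_row A = m" "elements_mat A \<subseteq> L"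
    show "w \<star> A = line A i"
    proof (rule eq_matI)
      fix p j assume "p < dim_row (line A i)" "j < dim_col (line A i)"
      then have j: "j < dim_col A" "p = 0" by (auto simp: line_def)
      have L: "A $$ (k, j) \<in> L" if "k < m" for k using A j that index_in_elements_mat[of k A j] by auto
      have "(w \<star> A) $$ (p, j) =
          sum_upto (\<lambda>k. (if k = i then e else z) * A $$ (k, j)) (m - 1)"
        using A i j by (auto simp: index_mat_prod w_def intro!: sum_upto_cong)
      also have "\<dots> = e * A $$ (i, j)"
        using i by (subst sum_upto_single[where j = i]) (auto simp: z e L)
      also have "\<dots> = A $$ (i, j)" using e L i by blast
      finally show "(w \<star> A) $$ (p, j) = line A i $$ (p, j)" using j by (simp add: line_def)
    qed (auto simp: line_def w_def)
  qed
qed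

lemma column_in_Col:
  fixes A :: "'a::semiring_local_id mat"
  assumes "j < dim_col A"
  shows "column A j \<in> Col A"
proof -
  obtain w where "w \<in> carrier_mat (dim_col A) 1" and "A \<star> w = column A j"
    using local_unit_col[OF finite_elements_mat[of A] assms] by blast
  then show ?thesis unfolding Col_def mem_Collect_eq by metis
qed

lemma line_in_Row:
  fixes A :: "'a::semiring_local_id mat"
  assumes "i < dim_row A"
  shows "line A i \<in> Row A"
proof -
  obtain w where "w \<in> carrier_mat 1 (dim_row A)" and "w \<star> A = line A i"
    using local_unit_row[OF finite_elements_mat[of A] assms] by blast
  then show ?thesis unfolding Row_def mem_Collect_eq by metis
qed

lemma row_eqI:
  fixes x :: "'a::semiring_local_id mat"
  assumes x: "x \<in> carrier_mat 1 n" "x' \<in> carrier_mat 1 n"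
    and eq: "\<And>v. v \<in> carrier_mat n 1 \<Longrightarrow> x \<star> v = x' \<star> v"
  shows "x = x'"
proof (rule eq_matI)
  fix i j assume ij: "i < dim_row x'" "j < dim_col x'"
  have "finite (elements_mat x \<union> elements_mat x')" by (simp add: finite_elements_mat)
  then obtain w where "w \<in> carrier_mat n 1" and
    w: "\<And>A. dim_col A = n \<Longrightarrow> elements_mat A \<subseteq> elements_mat x \<union> elements_mat x' \<Longrightarrow>
      A \<star> w = column A j"
    using local_unit_col ij x by (metis carrier_matD(2))
  then have "column x j = column x' j"
    using eq[of w] w[of x] w[of x'] x by simp
  then have "column x j $$ (i, 0) = column x' j $$ (i, 0)" by simp
  then show "x $$ (i, j) = x' $$ (i, j)" using ij x by (simp add: column_def)
qed (use x in auto)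

lemma col_eqI:
  fixes y :: "'a::semiring_local_id mat"
  assumes y: "y \<in> carrier_mat m 1" "y' \<in> carrier_mat m 1"
    and eq: "\<And>u. u \<in> carrier_mat 1 m \<Longrightarrow> u \<star> y = u \<star> y'"
  shows "y = y'"
proof (rule eq_matI)
  fix i j assume ij: "i < dim_row y'" "j < dim_col y'"
  have "finite (elements_mat y \<union> elements_mat y')" by (simp add: finite_elements_mat)
  then obtain w where "w \<in> carrier_mat 1 m" and
    w: "\<And>A. dim_row A = m \<Longrightarrow> elements_mat A \<subseteq> elements_mat y \<union> elements_mat y' \<Longrightarrow>
      w \<star> A = line A i"
    using local_unit_row ij y by (metis carrier_matD(1))
  then have "line y i = line y' i"
    using eq[of w] w[of y] w[of y'] y by simp
  then have "line y i $$ (0, j) = line y' i $$ (0, j)" by simp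
  then show "y $$ (i, j) = y' $$ (i, j)" using ij y by (simp add: line_def)
qed (use y in auto)

section \<open>Linear functions are given by vectors\<close>

lemma Col_lincomb:
  assumes A: "A \<in> carrier_mat m n" "0 < n" and xy: "x \<in> Col A" "y \<in> Col A"
  shows "x \<cdot>\<^sub>r a + y \<cdot>\<^sub>r b \<in> Col A"
proof -
  obtain v w where vw: "v \<in> carrier_mat n 1" "w \<in> carrier_mat n 1" "x = A \<star> v" "y = A \<star> w"
    using xy unfolding Col_def carrier_matD(2)[OF A(1)] by blast
  have "v \<cdot>\<^sub>r a + w \<cdot>\<^sub>r b \<in> carrier_mat (dim_col A) 1"
    using vw(1,2) A(1) by (simp add: smult_mat_right_def)
  then show ?thesis
    unfolding vw(3,4) mat_prod_add_right[OF A(1) vw(1,2) A(2), symmetric] Col_def by blast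
qed

lemma Row_lincomb:
  assumes A: "A \<in> carrier_mat m n" "0 < m" and xy: "x \<in> Row A" "y \<in> Row A"
  shows "a \<cdot>\<^sub>m x + b \<cdot>\<^sub>m y \<in> Row A"
proof -
  obtain v w where vw: "v \<in> carrier_mat 1 m" "w \<in> carrier_mat 1 m" "x = v \<star> A" "y = w \<star> A"
    using xy unfolding Row_def carrier_matD(1)[OF A(1)] by blast
  have "a \<cdot>\<^sub>m v + b \<cdot>\<^sub>m w \<in> carrier_mat 1 (dim_row A)" using vw(1,2) A(1) by simp
  then show ?thesis
    unfolding vw(3,4) mat_prod_add_left[OF A(1) vw(1,2) A(2), symmetric] Row_def by blast
qed

text \<open>
  Linearity is only given for combinations of two terms. It is applied along the partial sums of
  \<open>A \<star> v\<close>; a missing coefficient or a missing second term is supplied by a local identity or a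
  local zero. These are chosen for the entries of the vectors involved and for their images under
  \<open>\<phi>\<close> at once, so that the same scalar disappears on both sides of the linearity equation.
\<close>

lemma Col_dual_representation:
  fixes A :: "'a::semiring_local_id mat"
  assumes A: "A \<in> carrier_mat m n" "0 < n" and \<phi>: "\<phi> \<in> Col_dual A"
    and v: "v \<in> carrier_mat n 1"
  shows "\<phi> (A \<star> v) = (mat 1 n (\<lambda>(_, j). \<phi> (column A j)) \<star> v) $$ (0, 0)"
proof -
  have lin: "\<phi> (x \<cdot>\<^sub>r a + y \<cdot>\<^sub>r b) = \<phi> x * a + \<phi> y * b" if "x \<in> Col A" "y \<in> Col A" for x y a b
    using \<phi> that by (simp add: Col_dual_def)
  have col: "column A j \<in> Col A" if "j < n" for j using column_in_Col A that by auto
  define c where "c k = mat m 1 (\<lambda>(i, _). sum_upto (\<lambda>j. A $$ (i, j) * v $$ (j, 0)) k)" for k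
  have fin: "finite (elements_mat B)" for B :: "'a mat" by (rule finite_elements_mat)
  have "c k \<in> Col A \<and> \<phi> (c k) = sum_upto (\<lambda>j. \<phi> (column A j) * v $$ (j, 0)) k"
    if "k < n" for k
    using that
  proof (induction k)
    case 0
    let ?L = "{\<phi> (column A 0), \<phi> (column A 0) * v $$ (0, 0)} \<union>
      elements_mat (column A 0) \<union> elements_mat (c 0)"
    have "finite ?L" using fin by simp
    then obtain z where z: "\<And>a b. a \<in> ?L \<Longrightarrow> b \<in> ?L \<Longrightarrow> a + b * z = a"
      using local_id[of ?L] by blast
    have c0: "c 0 = column A 0 \<cdot>\<^sub>r v $$ (0, 0) + column A 0 \<cdot>\<^sub>r z"
    proof (rule eq_matI)
      fix i q assume "i < dim_row (column A 0 \<cdot>\<^sub>r v $$ (0, 0) + column A 0 \<cdot>\<^sub>r z)"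
        "q < dim_col (column A 0 \<cdot>\<^sub>r v $$ (0, 0) + column A 0 \<cdot>\<^sub>r z)"
      then have iq: "i < m" "q = 0" using A by (auto simp: column_def smult_mat_right_def)
      have "c 0 $$ (i, 0) \<in> ?L" "column A 0 $$ (i, 0) \<in> ?L"
        using iq A by (auto simp: c_def column_def intro!: index_in_elements_mat)
      then have "c 0 $$ (i, 0) + column A 0 $$ (i, 0) * z = c 0 $$ (i, 0)" by (rule z)
      then show "c 0 $$ (i, q) = (column A 0 \<cdot>\<^sub>r v $$ (0, 0) + column A 0 \<cdot>\<^sub>r z) $$ (i, q)"
        using iq A by (simp add: c_def column_def smult_mat_right_def)
    qed (use A in \<open>auto simp: c_def column_def smult_mat_right_def\<close>)
    have "\<phi> (c 0) = \<phi> (column A 0) * v $$ (0, 0) + \<phi> (column A 0) * z"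
      unfolding c0 using lin col 0 by blast
    also have "\<dots> = \<phi> (column A 0) * v $$ (0, 0)" by (rule z) auto
    finally show ?case using c0 Col_lincomb[OF A] col 0 by simp
  next
    case (Suc k)
    then have IH: "c k \<in> Col A" "\<phi> (c k) = sum_upto (\<lambda>j. \<phi> (column A j) * v $$ (j, 0)) k"
      by auto
    let ?L = "{\<phi> (c k)} \<union> elements_mat (c k)"
    have "finite ?L" using fin by simp
    then obtain e where e: "\<And>a. a \<in> ?L \<Longrightarrow> a * e = a"
      using local_id[of ?L] by blast
    have cS: "c (Suc k) = c k \<cdot>\<^sub>r e + column A (Suc k) \<cdot>\<^sub>r v $$ (Suc k, 0)"
    proof (rule eq_matI)
      fix i q assume "i < dim_row (c k \<cdot>\<^sub>r e + column A (Suc k) \<cdot>\<^sub>r v $$ (Suc k, 0))"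
        "q < dim_col (c k \<cdot>\<^sub>r e + column A (Suc k) \<cdot>\<^sub>r v $$ (Suc k, 0))"
      then have iq: "i < m" "q = 0" using A by (auto simp: column_def smult_mat_right_def)
      have "c k $$ (i, 0) \<in> ?L" using iq by (auto simp: c_def intro!: index_in_elements_mat)
      then have "c k $$ (i, 0) * e = c k $$ (i, 0)" by (rule e)
      then show "c (Suc k) $$ (i, q) =
          (c k \<cdot>\<^sub>r e + column A (Suc k) \<cdot>\<^sub>r v $$ (Suc k, 0)) $$ (i, q)"
        using iq A by (simp add: c_def column_def smult_mat_right_def)
    qed (use A in \<open>auto simp: c_def column_def smult_mat_right_def\<close>)
    have "\<phi> (c (Suc k)) = \<phi> (c k) * e + \<phi> (column A (Suc k)) * v $$ (Suc k, 0)"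
      unfolding cS using lin col IH(1) Suc.prems by blast
    also have "\<phi> (c k) * e = \<phi> (c k)" by (rule e) auto
    finally show ?case using cS Col_lincomb[OF A IH(1)] col Suc.prems IH(2) by simp
  qed
  then have "\<phi> (c (n - 1)) = sum_upto (\<lambda>j. \<phi> (column A j) * v $$ (j, 0)) (n - 1)"
    using A by simp
  moreover have "A \<star> v = c (n - 1)" using A v by (auto simp: mat_prod_def c_def)
  ultimately show ?thesis using A v by (auto simp: index_mat_prod intro!: sum_upto_cong)
qed

lemma Row_dual_representation:
  fixes A :: "'a::semiring_local_id mat"
  assumes A: "A \<in> carrier_mat m n" "0 < m" and \<phi>: "\<phi> \<in> Row_dual A"
    and u: "u \<in> carrier_mat 1 m"
  shows "\<phi> (u \<star> A) = (u \<star> mat m 1 (\<lambda>(i, _). \<phi> (line A i))) $$ (0, 0)"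
proof -
  have lin: "\<phi> (a \<cdot>\<^sub>m x + b \<cdot>\<^sub>m y) = a * \<phi> x + b * \<phi> y" if "x \<in> Row A" "y \<in> Row A" for x y a b
    using \<phi> that by (simp add: Row_dual_def)
  have row: "line A i \<in> Row A" if "i < m" for i using line_in_Row A that by auto
  define r where "r k = mat 1 n (\<lambda>(_, j). sum_upto (\<lambda>i. u $$ (0, i) * A $$ (i, j)) k)" for k
  have fin: "finite (elements_mat B)" for B :: "'a mat" by (rule finite_elements_mat)
  have "r k \<in> Row A \<and> \<phi> (r k) = sum_upto (\<lambda>i. u $$ (0, i) * \<phi> (line A i)) k"
    if "k < m" for k
    using that
  proof (induction k)
    case 0
    let ?L = "{\<phi> (line A 0), u $$ (0, 0) * \<phi> (line A 0)} \<union>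
      elements_mat (line A 0) \<union> elements_mat (r 0)"
    have "finite ?L" using fin by simp
    then obtain z where z: "\<And>a b. a \<in> ?L \<Longrightarrow> b \<in> ?L \<Longrightarrow> a + z * b = a"
      using local_id[of ?L] by blast
    have r0: "r 0 = u $$ (0, 0) \<cdot>\<^sub>m line A 0 + z \<cdot>\<^sub>m line A 0"
    proof (rule eq_matI)
      fix p j assume "p < dim_row (u $$ (0, 0) \<cdot>\<^sub>m line A 0 + z \<cdot>\<^sub>m line A 0)"
        "j < dim_col (u $$ (0, 0) \<cdot>\<^sub>m line A 0 + z \<cdot>\<^sub>m line A 0)"
      then have pj: "j < n" "p = 0" using A by (auto simp: line_def)
      have "r 0 $$ (0, j) \<in> ?L" "line A 0 $$ (0, j) \<in> ?L"
        using pj A by (auto simp: r_def line_def intro!: index_in_elements_mat)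
      then have "r 0 $$ (0, j) + z * line A 0 $$ (0, j) = r 0 $$ (0, j)" by (rule z)
      then show "r 0 $$ (p, j) = (u $$ (0, 0) \<cdot>\<^sub>m line A 0 + z \<cdot>\<^sub>m line A 0) $$ (p, j)"
        using pj A by (simp add: r_def line_def)
    qed (use A in \<open>auto simp: r_def line_def\<close>)
    have "\<phi> (r 0) = u $$ (0, 0) * \<phi> (line A 0) + z * \<phi> (line A 0)"
      unfolding r0 using lin row 0 by blast
    also have "\<dots> = u $$ (0, 0) * \<phi> (line A 0)" by (rule z) auto
    finally show ?case using r0 Row_lincomb[OF A] row 0 by simp
  next
    case (Suc k)
    then have IH: "r k \<in> Row A" "\<phi> (r k) = sum_upto (\<lambda>i. u $$ (0, i) * \<phi> (line A i)) k"
      by auto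
    let ?L = "{\<phi> (r k)} \<union> elements_mat (r k)"
    have "finite ?L" using fin by simp
    then obtain e where e: "\<And>a. a \<in> ?L \<Longrightarrow> e * a = a"
      using local_id[of ?L] by blast
    have rS: "r (Suc k) = e \<cdot>\<^sub>m r k + u $$ (0, Suc k) \<cdot>\<^sub>m line A (Suc k)"
    proof (rule eq_matI)
      fix p j assume "p < dim_row (e \<cdot>\<^sub>m r k + u $$ (0, Suc k) \<cdot>\<^sub>m line A (Suc k))"
        "j < dim_col (e \<cdot>\<^sub>m r k + u $$ (0, Suc k) \<cdot>\<^sub>m line A (Suc k))"
      then have pj: "j < n" "p = 0" using A by (auto simp: line_def)
      have "r k $$ (0, j) \<in> ?L" using pj by (auto simp: r_def intro!: index_in_elements_mat)
      then have "e * r k $$ (0, j) = r k $$ (0, j)" by (rule e)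
      then show "r (Suc k) $$ (p, j) =
          (e \<cdot>\<^sub>m r k + u $$ (0, Suc k) \<cdot>\<^sub>m line A (Suc k)) $$ (p, j)"
        using pj A by (simp add: r_def line_def)
    qed (use A in \<open>auto simp: r_def line_def\<close>)
    have "\<phi> (r (Suc k)) = e * \<phi> (r k) + u $$ (0, Suc k) * \<phi> (line A (Suc k))"
      unfolding rS using lin row IH(1) Suc.prems by blast
    also have "e * \<phi> (r k) = \<phi> (r k)" by (rule e) auto
    finally show ?case using rS Row_lincomb[OF A IH(1)] row Suc.prems IH(2) by simp
  qed
  then have "\<phi> (r (m - 1)) = sum_upto (\<lambda>i. u $$ (0, i) * \<phi> (line A i)) (m - 1)"
    using A by simp
  moreover have "u \<star> A = r (m - 1)" using A u by (auto simp: mat_prod_def r_def)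
  ultimately show ?thesis using A u by (auto simp: index_mat_prod intro!: sum_upto_cong)
qed

text \<open>
  Conversely, a row \<open>x\<close> induces a right linear function on \<open>Col A\<close> as soon as \<open>x \<star> v\<close> depends only
  on \<open>A \<star> v\<close>; membership of \<open>x\<close> in \<open>Row A\<close> is not needed.
\<close>

lemma Col_dual_of_row:
  assumes A: "A \<in> carrier_mat m n" "0 < n" and x: "x \<in> carrier_mat 1 n"
    and resp: "\<And>v v'. v \<in> carrier_mat n 1 \<Longrightarrow> v' \<in> carrier_mat n 1 \<Longrightarrow> A \<star> v = A \<star> v' \<Longrightarrow>
      x \<star> v = x \<star> v'"
  obtains \<phi> where "\<phi> \<in> Col_dual A"
    and "\<And>v. v \<in> carrier_mat n 1 \<Longrightarrow> \<phi> (A \<star> v) = (x \<star> v) $$ (0, 0)"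
proof -
  define \<phi> where "\<phi> = (\<lambda>y\<in>Col A. (x \<star> (SOME v. v \<in> carrier_mat n 1 \<and> y = A \<star> v)) $$ (0, 0))"
  have val: "\<phi> (A \<star> v) = (x \<star> v) $$ (0, 0)" if v: "v \<in> carrier_mat n 1" for v
  proof -
    let ?w = "SOME w. w \<in> carrier_mat n 1 \<and> A \<star> v = A \<star> w"
    have "?w \<in> carrier_mat n 1 \<and> A \<star> v = A \<star> ?w" using v by (intro someI) auto
    then have "x \<star> ?w = x \<star> v" using resp v by metis
    moreover have "A \<star> v \<in> Col A" using A v by (auto simp: Col_def)
    ultimately show ?thesis by (simp add: \<phi>_def)
  qed
  have "\<phi> (y \<cdot>\<^sub>r a + z \<cdot>\<^sub>r b) = \<phi> y * a + \<phi> z * b" if yz: "y \<in> Col A" "z \<in> Col A" for y z a b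
  proof -
    obtain v w where vw: "v \<in> carrier_mat n 1" "w \<in> carrier_mat n 1" "y = A \<star> v" "z = A \<star> w"
      using yz unfolding Col_def carrier_matD(2)[OF A(1)] by blast
    have c: "v \<cdot>\<^sub>r a + w \<cdot>\<^sub>r b \<in> carrier_mat n 1" using vw(1,2) by (simp add: smult_mat_right_def)
    have "\<phi> (y \<cdot>\<^sub>r a + z \<cdot>\<^sub>r b) = (x \<star> (v \<cdot>\<^sub>r a + w \<cdot>\<^sub>r b)) $$ (0, 0)"
      using mat_prod_add_right[OF A(1) vw(1,2) A(2)] val[OF c] vw(3,4) by simp
    also have "\<dots> = (x \<star> v) $$ (0, 0) * a + (x \<star> w) $$ (0, 0) * b"
      unfolding mat_prod_add_right[OF x vw(1,2) A(2)]
      using vw(1,2) x by (simp add: smult_mat_right_def)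
    finally show ?thesis using val vw by simp
  qed
  moreover have "\<phi> \<in> Col A \<rightarrow>\<^sub>E UNIV" by (simp add: \<phi>_def)
  ultimately have "\<phi> \<in> Col_dual A" unfolding Col_dual_def by blast
  then show thesis using val that by blast
qed

lemma Row_dual_of_col:
  assumes A: "A \<in> carrier_mat m n" "0 < m" and y: "y \<in> carrier_mat m 1"
    and resp: "\<And>u u'. u \<in> carrier_mat 1 m \<Longrightarrow> u' \<in> carrier_mat 1 m \<Longrightarrow> u \<star> A = u' \<star> A \<Longrightarrow>
      u \<star> y = u' \<star> y"
  obtains \<phi> where "\<phi> \<in> Row_dual A"
    and "\<And>u. u \<in> carrier_mat 1 m \<Longrightarrow> \<phi> (u \<star> A) = (u \<star> y) $$ (0, 0)"
proof -
  define \<phi> where "\<phi> = (\<lambda>x\<in>Row A. ((SOME u. u \<in> carrier_mat 1 m \<and> x = u \<star> A) \<star> y) $$ (0, 0))"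
  have val: "\<phi> (u \<star> A) = (u \<star> y) $$ (0, 0)" if u: "u \<in> carrier_mat 1 m" for u
  proof -
    let ?w = "SOME w. w \<in> carrier_mat 1 m \<and> u \<star> A = w \<star> A"
    have "?w \<in> carrier_mat 1 m \<and> u \<star> A = ?w \<star> A" using u by (intro someI) auto
    then have "?w \<star> y = u \<star> y" using resp u by metis
    moreover have "u \<star> A \<in> Row A" using A u by (auto simp: Row_def)
    ultimately show ?thesis by (simp add: \<phi>_def)
  qed
  have "\<phi> (a \<cdot>\<^sub>m x + b \<cdot>\<^sub>m z) = a * \<phi> x + b * \<phi> z" if xz: "x \<in> Row A" "z \<in> Row A" for x z a b
  proof -
    obtain v w where vw: "v \<in> carrier_mat 1 m" "w \<in> carrier_mat 1 m" "x = v \<star> A" "z = w \<star> A"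
      using xz unfolding Row_def carrier_matD(1)[OF A(1)] by blast
    have c: "a \<cdot>\<^sub>m v + b \<cdot>\<^sub>m w \<in> carrier_mat 1 m" using vw(1,2) by simp
    have "\<phi> (a \<cdot>\<^sub>m x + b \<cdot>\<^sub>m z) = ((a \<cdot>\<^sub>m v + b \<cdot>\<^sub>m w) \<star> y) $$ (0, 0)"
      using mat_prod_add_left[OF A(1) vw(1,2) A(2)] val[OF c] vw(3,4) by simp
    also have "\<dots> = a * (v \<star> y) $$ (0, 0) + b * (w \<star> y) $$ (0, 0)"
      unfolding mat_prod_add_left[OF y vw(1,2) A(2)]
      using vw(1,2) y by simp
    finally show ?thesis using val vw by simp
  qed
  moreover have "\<phi> \<in> Row A \<rightarrow>\<^sub>E UNIV" by (simp add: \<phi>_def)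
  ultimately have "\<phi> \<in> Row_dual A" unfolding Row_dual_def by blast
  then show thesis using val that by blast
qed

section \<open>Separation is equivalent to surjectivity, matrix by matrix\<close>

lemma Col_dual_eqI:
  assumes A: "A \<in> carrier_mat m n" and \<phi>: "\<phi> \<in> Col_dual A" "\<psi> \<in> Col_dual A"
    and eq: "\<And>v. v \<in> carrier_mat n 1 \<Longrightarrow> \<phi> (A \<star> v) = \<psi> (A \<star> v)"
  shows "\<phi> = \<psi>"
proof (rule PiE_ext)
  show "\<phi> \<in> Col A \<rightarrow>\<^sub>E UNIV" "\<psi> \<in> Col A \<rightarrow>\<^sub>E UNIV" using \<phi> by (simp_all add: Col_dual_def)
qed (use A eq in \<open>auto simp: Col_def\<close>)

lemma Row_dual_eqI:
  assumes A: "A \<in> carrier_mat m n" and \<phi>: "\<phi> \<in> Row_dual A" "\<psi> \<in> Row_dual A"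
    and eq: "\<And>u. u \<in> carrier_mat 1 m \<Longrightarrow> \<phi> (u \<star> A) = \<psi> (u \<star> A)"
  shows "\<phi> = \<psi>"
proof (rule PiE_ext)
  show "\<phi> \<in> Row A \<rightarrow>\<^sub>E UNIV" "\<psi> \<in> Row A \<rightarrow>\<^sub>E UNIV" using \<phi> by (simp_all add: Row_dual_def)
qed (use A eq in \<open>auto simp: Row_def\<close>)

lemma mat_1_1_eqI:
  "A \<in> carrier_mat 1 1 \<Longrightarrow> B \<in> carrier_mat 1 1 \<Longrightarrow> A $$ (0, 0) = B $$ (0, 0) \<Longrightarrow> A = B"
  by (auto intro!: eq_matI)

lemma Row_separation_iff_surj:
  fixes A :: "'a::semiring_local_id mat"
  assumes A: "A \<in> carrier_mat m n" "0 < m" "0 < n"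
  shows "(\<forall>x \<in> carrier_mat 1 n - Row A.
      \<exists>v\<in>carrier_mat n 1. \<exists>v'\<in>carrier_mat n 1. A \<star> v = A \<star> v' \<and> x \<star> v \<noteq> x \<star> v') \<longleftrightarrow>
    Row_to_Col_dual A ` Row A = Col_dual A" (is "?E \<longleftrightarrow> ?G")
proof
  assume E: ?E
  have "\<phi> \<in> Row_to_Col_dual A ` Row A" if \<phi>: "\<phi> \<in> Col_dual A" for \<phi>
  proof -
    define x where "x = mat 1 n (\<lambda>(_, j). \<phi> (column A j))"
    have xc: "x \<in> carrier_mat 1 n" by (simp add: x_def)
    have rep: "\<phi> (A \<star> v) = (x \<star> v) $$ (0, 0)" if "v \<in> carrier_mat n 1" for v
      unfolding x_def using Col_dual_representation[OF A(1,3) \<phi> that] .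
    have "x \<star> v = x \<star> v'"
      if "v \<in> carrier_mat n 1" "v' \<in> carrier_mat n 1" "A \<star> v = A \<star> v'" for v v'
      using that rep[of v] rep[of v'] xc by (intro mat_1_1_eqI mat_prod_carrier) auto
    then have x: "x \<in> Row A" using E xc by blast
    have "\<phi> = Row_to_Col_dual A x"
      using Row_to_Col_dual_in_dual[OF A x] Row_to_Col_dual_apply[OF A x] rep
      by (intro Col_dual_eqI[OF A(1) \<phi>]) auto
    then show ?thesis using x by blast
  qed
  then show ?G using Row_to_Col_dual_in_dual[OF A] by blast
next
  assume G: ?G
  have "x \<in> Row A" if x: "x \<in> carrier_mat 1 n"
    and resp: "\<And>v v'. v \<in> carrier_mat n 1 \<Longrightarrow> v' \<in> carrier_mat n 1 \<Longrightarrow> A \<star> v = A \<star> v' \<Longrightarrow>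
      x \<star> v = x \<star> v'" for x
  proof -
    obtain \<phi> where \<phi>: "\<phi> \<in> Col_dual A"
      "\<And>v. v \<in> carrier_mat n 1 \<Longrightarrow> \<phi> (A \<star> v) = (x \<star> v) $$ (0, 0)"
      using Col_dual_of_row[OF A(1,3) x resp] by blast
    then obtain x' where x': "x' \<in> Row A" "\<phi> = Row_to_Col_dual A x'" using G by blast
    have x'c: "x' \<in> carrier_mat 1 n" using x'(1) A by (auto simp: Row_def)
    have "x \<star> v = x' \<star> v" if v: "v \<in> carrier_mat n 1" for v
      using \<phi>(2)[OF v] Row_to_Col_dual_apply[OF A x'(1) v] x'(2) v x x'c
      by (intro mat_1_1_eqI mat_prod_carrier) auto
    then show ?thesis using row_eqI[OF x x'c] x'(1) by blast
  qed
  then show ?E by blast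
qed

lemma Col_separation_iff_surj:
  fixes A :: "'a::semiring_local_id mat"
  assumes A: "A \<in> carrier_mat m n" "0 < m" "0 < n"
  shows "(\<forall>y \<in> carrier_mat m 1 - Col A.
      \<exists>u\<in>carrier_mat 1 m. \<exists>u'\<in>carrier_mat 1 m. u \<star> A = u' \<star> A \<and> u \<star> y \<noteq> u' \<star> y) \<longleftrightarrow>
    Col_to_Row_dual A ` Col A = Row_dual A" (is "?E \<longleftrightarrow> ?G")
proof
  assume E: ?E
  have "\<phi> \<in> Col_to_Row_dual A ` Col A" if \<phi>: "\<phi> \<in> Row_dual A" for \<phi>
  proof -
    define y where "y = mat m 1 (\<lambda>(i, _). \<phi> (line A i))"
    have yc: "y \<in> carrier_mat m 1" by (simp add: y_def)
    have rep: "\<phi> (u \<star> A) = (u \<star> y) $$ (0, 0)" if "u \<in> carrier_mat 1 m" for u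
      unfolding y_def using Row_dual_representation[OF A(1,2) \<phi> that] .
    have "u \<star> y = u' \<star> y"
      if "u \<in> carrier_mat 1 m" "u' \<in> carrier_mat 1 m" "u \<star> A = u' \<star> A" for u u'
      using that rep[of u] rep[of u'] yc by (intro mat_1_1_eqI mat_prod_carrier) auto
    then have y: "y \<in> Col A" using E yc by blast
    have "\<phi> = Col_to_Row_dual A y"
      using Col_to_Row_dual_in_dual[OF A y] Col_to_Row_dual_apply[OF A y] rep
      by (intro Row_dual_eqI[OF A(1) \<phi>]) auto
    then show ?thesis using y by blast
  qed
  then show ?G using Col_to_Row_dual_in_dual[OF A] by blast
next
  assume G: ?G
  have "y \<in> Col A" if y: "y \<in> carrier_mat m 1"
    and resp: "\<And>u u'. u \<in> carrier_mat 1 m \<Longrightarrow> u' \<in> carrier_mat 1 m \<Longrightarrow> u \<star> A = u' \<star> A \<Longrightarrow>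
      u \<star> y = u' \<star> y" for y
  proof -
    obtain \<phi> where \<phi>: "\<phi> \<in> Row_dual A"
      "\<And>u. u \<in> carrier_mat 1 m \<Longrightarrow> \<phi> (u \<star> A) = (u \<star> y) $$ (0, 0)"
      using Row_dual_of_col[OF A(1,2) y resp] by blast
    then obtain y' where y': "y' \<in> Col A" "\<phi> = Col_to_Row_dual A y'" using G by blast
    have y'c: "y' \<in> carrier_mat m 1" using y'(1) A by (auto simp: Col_def)
    have "u \<star> y = u \<star> y'" if u: "u \<in> carrier_mat 1 m" for u
      using \<phi>(2)[OF u] Col_to_Row_dual_apply[OF A y'(1) u] y'(2) u y y'c
      by (intro mat_1_1_eqI mat_prod_carrier) auto
    then show ?thesis using col_eqI[OF y y'c] y'(1) by blast
  qed
  then show ?E by blast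
qed

theorem theorem3p3:
  shows "exact_semiring TYPE('a::semiring_local_id) \<longleftrightarrow>
    (\<forall>m n. 0 < m \<longrightarrow> 0 < n \<longrightarrow> (\<forall>A :: 'a mat \<in> carrier_mat m n.
       Row_to_Col_dual A ` Row A = Col_dual A \<and>
       Col_to_Row_dual A ` Col A = Row_dual A))"
  unfolding exact_semiring_def
  by (intro iff_allI imp_cong ball_cong conj_cong refl
      Row_separation_iff_surj Col_separation_iff_surj)

end
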